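(* Let $W$ be a word over the alphabet $\{A,B\}$ in which at least one of the two letters $A$, $B$ appears at most twice. Then $W$ is nearly symmetric.
   Context: A word is a finite sequence of letters from the alphabet $\{A,B\}$ (repetition allowed). It is symmetric if it reads the same right to left as left to right; the empty word counts as symmetric. A word is nearly symmetric if it is either symmetric or the juxtaposition (concatenation) of two symmetric words. *)

theory Defs imports Main begin

datatype letter = A | B

type_synonym word = "letter list"

definition symmetric :: "word \<Rightarrow> bool" where
  "symmetric w \<longleftrightarrow> rev w = w"

definition nearly_symmetric :: "word \<Rightarrow> bool" where
  "nearly_symmetric w \<longleftrightarrow>
     symmetric w \<or> (\<exists>u v. symmetric u \<and> symmetric v \<and> w = u @ v)"

end

theory Submission imports Defs begin

text \<open>
  Let \<open>x\<close> be a letter occurring at most twice, and \<open>y\<close> the other letter. Deleting the maximal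
  runs of \<open>y\<close> at the two ends of the word leaves a core that is empty, \<open>x\<close>, or \<open>x y\<^sup>j x\<close>, so
  the core is symmetric (\<open>few_occurrences_core\<close>). The word is therefore \<open>y\<^sup>i c y\<^sup>k\<close> with \<open>c\<close>
  symmetric, and cutting off the surplus \<open>y\<close>s of the longer run leaves a symmetric word next
  to a power of \<open>y\<close> (\<open>nearly_symmetric_padded\<close>).
\<close>

lemma symmetric_replicate: "symmetric (replicate n y)"
  by (simp add: symmetric_def)

lemma symmetric_padded:
  "symmetric c \<Longrightarrow> symmetric (replicate i y @ c @ replicate i y)"
  by (simp add: symmetric_def)

lemma nearly_symmetric_append:
  "symmetric u \<Longrightarrow> symmetric v \<Longrightarrow> nearly_symmetric (u @ v)"
  by (auto simp: nearly_symmetric_def)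

text \<open>
  The run lengths \<open>i\<close> and \<open>k\<close> may differ: the smaller of them bounds a symmetric padding of
  \<open>c\<close>, and what remains of the longer run is itself symmetric.
\<close>

lemma nearly_symmetric_padded:
  assumes "symmetric c"
  shows "nearly_symmetric (replicate i y @ c @ replicate k y)"
proof (cases "i \<le> k")
  case True
  then have "replicate k y = replicate i y @ replicate (k - i) y"
    by (simp flip: replicate_add)
  then have "replicate i y @ c @ replicate k y =
      (replicate i y @ c @ replicate i y) @ replicate (k - i) y"
    by simp
  then show ?thesis
    using nearly_symmetric_append[OF symmetric_padded[OF assms] symmetric_replicate] by metis
next
  case False
  then have "replicate i y = replicate (i - k) y @ replicate k y"
    by (simp flip: replicate_add)
  then have "replicate i y @ c @ replicate k y =
      replicate (i - k) y @ (replicate k y @ c @ replicate k y)"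
    by simp
  then show ?thesis
    using nearly_symmetric_append[OF symmetric_replicate symmetric_padded[OF assms]] by metis
qed

lemma other_letter_power:
  fixes w :: word
  assumes "x \<noteq> y" and "x \<notin> set w"
  shows "w = replicate (length w) y"
proof -
  have "z = y" if "z \<noteq> x" for z
    using that assms(1) by (cases x; cases y; cases z) auto
  then have "\<forall>z\<in>set w. z = y"
    using assms(2) by metis
  then show ?thesis
    by (simp add: replicate_length_same)
qed

text \<open>
  Cutting at the first and the last occurrence of \<open>x\<close>, the outer pieces are free of \<open>x\<close> by the
  choice of the cuts, and the inner piece is free of \<open>x\<close> because both occurrences are used up.
\<close>

lemma few_occurrences_core:
  fixes w :: word
  assumes "x \<noteq> y" and "count_list w x \<le> 2"
  obtains i c k where "symmetric c" and "w = replicate i y @ c @ replicate k y"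
proof (cases "x \<in> set w")
  case False
  have "symmetric []"
    by (simp add: symmetric_def)
  moreover have "w = replicate (length w) y @ [] @ replicate 0 y"
    using other_letter_power[OF assms(1) False] by simp
  ultimately show thesis
    by (rule that)
next
  case True
  then obtain us vs where w: "w = us @ x # vs" and us: "x \<notin> set us"
    using split_list_first by metis
  show thesis
  proof (cases "x \<in> set vs")
    case False
    have "symmetric [x]"
      by (simp add: symmetric_def)
    moreover have "w = replicate (length us) y @ [x] @ replicate (length vs) y"
      using w other_letter_power[OF assms(1) us] other_letter_power[OF assms(1) False] by simp
    ultimately show thesis
      by (rule that)
  next
    case True
    then obtain ms zs where vs: "vs = ms @ x # zs" and zs: "x \<notin> set zs"
      using split_list_last by metis
    have "count_list ms x = 0"
      using assms(2) by (simp add: w vs)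
    then have ms: "x \<notin> set ms"
      by (simp add: count_list_0_iff)
    have "symmetric (x # replicate (length ms) y @ [x])"
      by (simp add: symmetric_def)
    moreover have "w = replicate (length us) y @ (x # replicate (length ms) y @ [x])
        @ replicate (length zs) y"
      using w vs other_letter_power[OF assms(1) us] other_letter_power[OF assms(1) ms]
        other_letter_power[OF assms(1) zs]
      by simp
    ultimately show thesis
      by (rule that)
  qed
qed

theorem theorem1p4:
  fixes W :: word
  assumes "count_list W A \<le> 2 \<or> count_list W B \<le> 2"
  shows "nearly_symmetric W"
proof -
  obtain x y where "x \<noteq> y" and "count_list W x \<le> 2"
    using assms by (metis letter.distinct(1))
  then obtain i c k where "symmetric c" and "W = replicate i y @ c @ replicate k y"
    by (rule few_occurrences_core)
  then show ?thesis
    by (simp add: nearly_symmetric_padded)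
qed

end
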